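(* For any $w\in\mathbb{C}\setminus\{0,-2,-4,\ldots\}$ and any integer $p\geq 0$, \[ \sum_{k=0}^\infty\frac{\binom{2k}{k}}{4^k(2k+w)^{p+1}} =\frac{(-1)^p}{2\,p!}\cdot\frac{d^p}{dw^p}B\big(\tfrac{1}{2},\tfrac{w}{2}\big), \] and, as an identity of power series in $z$ (valid for $|z|$ sufficiently small), \[ \sum_{p=0}^\infty\left(\sum_{k=0}^\infty\frac{\binom{2k}{k}}{4^k(2k+w)^{p+1}}\right)z^p =\frac{1}{2}\cdot B\big(\tfrac{1}{2},\tfrac{w-z}{2}\big). \]
   Context: $B(a,b)=\frac{\Gamma(a)\Gamma(b)}{\Gamma(a+b)}$ is Euler's beta function (equal to $\int_0^1 t^{a-1}(1-t)^{b-1}dt$ when $\operatorname{Re}a,\operatorname{Re}b>0$), extended meromorphically; $\Gamma$ is Euler's gamma function. *)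

theory Defs
  imports "HOL-Complex_Analysis.Complex_Analysis"
begin

end

theory Submission
  imports Defs "HOL-Real_Asymp.Real_Asymp"
begin

text \<open>For \<open>p = 0\<close> and real \<open>w > 0\<close>, both sides are positive decreasing solutions of
  \<open>(x + 1) f(x + 2) = x f(x)\<close> with \<open>f(2) = 1\<close> (for the series the equation telescopes), and such a
  solution is unique, as in the Bohr--Mollerup theorem. The identity theorem extends the equality to
  the complement of the poles, termwise differentiation gives all \<open>p\<close>, and the power series is the
  Taylor expansion of the Beta function at \<open>w\<close>.\<close>

section \<open>Scaled central binomial coefficients: recursion and decay\<close>

definition cbin :: "nat \<Rightarrow> real" where
  "cbin k = of_nat ((2 * k) choose k) / 4 ^ k"

lemma cbin_0 [simp]: "cbin 0 = 1"
  by (simp add: cbin_def)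

lemma cbin_altdef: "cbin k = fact (2 * k) / (fact k ^ 2 * 4 ^ k)"
  unfolding cbin_def by (subst binomial_fact) (auto simp: power2_eq_square mult_2)

lemma cbin_Suc: "cbin (Suc k) * (2 * real k + 2) = cbin k * (2 * real k + 1)"
proof -
  define c where "c = real k + 1"
  have c: "c > 0" "2 * real k + 2 = 2 * c"
    by (simp_all add: c_def)
  have "cbin (Suc k) = (2 * c * ((2 * real k + 1) * fact (2 * k))) / ((c * fact k) ^ 2 * (4 * 4 ^ k))"
    by (simp add: cbin_altdef c_def algebra_simps)
  also have "\<dots> = cbin k * ((2 * real k + 1) * (2 * c) / (4 * c ^ 2))"
    unfolding cbin_altdef power_mult_distrib by (simp add: divide_simps)
  also have "\<dots> = cbin k * (2 * real k + 1) / (2 * c)"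
    using c(1) by (simp add: power2_eq_square field_simps)
  finally show ?thesis
    unfolding c(2) using c(1) by simp
qed

lemma cbin_nonneg: "cbin k \<ge> 0"
  by (simp add: cbin_def)

text \<open>By \<open>cbin_Suc\<close>, the induction step reduces to (2k+1)(2k+3) <= (2k+2)^2. The
  factor 2k+1 gives the decay k^(-1/2) that convergence at p = 0 requires.\<close>

lemma cbin_sq_le: "cbin k ^ 2 * (2 * real k + 1) \<le> 1"
proof (induction k)
  case (Suc k)
  let ?a = "2 * real k + 1" and ?b = "2 * real k + 2"
  have "(cbin (Suc k)) ^ 2 * (2 * real (Suc k) + 1) * ?b ^ 2 = (cbin (Suc k) * ?b) ^ 2 * (?a + 2)"
    by (simp add: power_mult_distrib add_ac)
  also have "\<dots> = (cbin k ^ 2 * ?a) * (?a * (?a + 2))"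
    by (simp only: cbin_Suc) (simp add: power2_eq_square)
  also have "\<dots> \<le> 1 * (?a * (?a + 2))"
    using Suc.IH by (intro mult_right_mono) auto
  also have "\<dots> \<le> 1 * ?b ^ 2"
    by (simp add: power2_eq_square algebra_simps)
  finally show ?case
    by (rule mult_right_le_imp_le) simp
qed simp

lemma cbin_le: "cbin k \<le> 1 / sqrt (2 * real k + 1)"
proof -
  have "cbin k = sqrt (cbin k ^ 2)"
    using cbin_nonneg by simp
  also have "\<dots> \<le> sqrt (1 / (2 * real k + 1))"
    using cbin_sq_le[of k] by (intro real_sqrt_le_mono) (simp add: field_simps)
  finally show ?thesis
    by (simp add: real_sqrt_divide)
qed

lemma cbin_tendsto_0: "cbin \<longlonglongrightarrow> 0"
proof (rule tendsto_sandwich[where f = "\<lambda>_. 0"])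
  show "(\<lambda>k. 1 / sqrt (2 * real k + 1)) \<longlonglongrightarrow> 0"
    by real_asymp
qed (auto simp: cbin_nonneg cbin_le)

text \<open>This is the common majorant for the real series and, locally in u, for the complex
  series with every p. Its term at k = 0 is 0 by the division convention, so the later comparisons
  start at k = 1.\<close>

lemma summable_cbin: "summable (\<lambda>k. cbin k / real k)"
proof (rule summable_comparison_test')
  show "summable (\<lambda>k. real k powr (- 3 / 2))"
    by (subst summable_real_powr_iff) auto
  fix k :: nat assume k: "k \<ge> 1"
  have "cbin k \<le> 1 / sqrt (2 * real k + 1)"
    by (rule cbin_le)
  also have "\<dots> \<le> 1 / sqrt (real k)"
    using k by (intro divide_left_mono) auto
  also have "\<dots> = real k powr (- 1 / 2)"
    using k by (simp add: powr_half_sqrt[symmetric] powr_minus_divide)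
  finally have "cbin k / real k \<le> real k powr (- 1 / 2) / real k powr 1"
    using k by (simp add: divide_right_mono)
  also have "\<dots> = real k powr (- 3 / 2)"
    by (subst powr_diff[symmetric]) auto
  finally show "norm (cbin k / real k) \<le> real k powr (- 3 / 2)"
    using cbin_nonneg[of k] by simp
qed

lemma summable_cbin_divide:
  assumes "x > 0"
  shows "summable (\<lambda>k. cbin k / (2 * real k + x))"
proof (rule summable_comparison_test'[OF summable_cbin])
  fix k :: nat assume "k \<ge> 1"
  then show "norm (cbin k / (2 * real k + x)) \<le> cbin k / real k"
    using assms cbin_nonneg[of k] by (auto intro!: divide_left_mono)
qed

section \<open>The real series for p = 0 and its identification with Beta on (0, 2]\<close>

definition cbin_series :: "real \<Rightarrow> real" where
  "cbin_series x = (\<Sum>k. cbin k / (2 * real k + x))"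

lemma cbin_series_antimono:
  assumes "0 < x" "x \<le> y"
  shows "cbin_series y \<le> cbin_series x"
  unfolding cbin_series_def using assms cbin_nonneg
  by (intro suminf_le summable_cbin_divide divide_left_mono) (auto intro!: mult_pos_pos add_nonneg_pos)

lemma cbin_series_pos:
  assumes "x > 0"
  shows "cbin_series x > 0"
  unfolding cbin_series_def
proof (rule suminf_pos2[OF summable_cbin_divide[OF assms]])
  show "0 \<le> cbin k / (2 * real k + x)" for k
    using assms cbin_nonneg[of k] by simp
  show "0 < cbin 0 / (2 * real 0 + x)"
    using assms by simp
qed

lemma cbin_series_rec:
  assumes "x > 0"
  shows "(x + 1) * cbin_series (x + 2) = x * cbin_series x"
proof -
  \<comment> \<open>The telescoping certificate: \<open>a 0 = 0\<close> and \<open>a\<close> tends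
    to 0, so its differences sum to 0, and these differences are the termwise form of the
    recurrence.\<close>
  define a where "a k = cbin k * (2 * real k / (2 * real k + x))" for k
  have "(\<lambda>k. 2 * real k / (2 * real k + x)) \<longlonglongrightarrow> 1"
    by real_asymp
  from tendsto_mult[OF cbin_tendsto_0 this] have "a \<longlonglongrightarrow> 0"
    unfolding a_def by simp
  from telescope_sums[OF this] have *: "(\<lambda>k. a (Suc k) - a k) sums 0"
    by (simp add: a_def)
  have eq: "a (Suc k) - a k = x * (cbin k / (2 * real k + x)) - (x + 1) * (cbin k / (2 * real k + (x + 2)))" for k
  proof -
    have "a (Suc k) = (cbin (Suc k) * (2 * real k + 2)) / (2 * real k + (x + 2))"
      by (simp add: a_def algebra_simps)
    \<comment> \<open>After \<open>cbin_Suc\<close> the numerator is 2k+1 = (2k+x+2) - (x+1).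
      Likewise \<open>a k\<close> is \<open>cbin k\<close> minus x times the term at x, so
      \<open>cbin k\<close> cancels in the difference.\<close>
    also have "\<dots> = cbin k - (x + 1) * (cbin k / (2 * real k + (x + 2)))"
      using assms unfolding cbin_Suc by (simp add: field_simps)
    finally show ?thesis
      using assms by (simp add: a_def field_simps)
  qed
  have "(\<lambda>k. x * (cbin k / (2 * real k + x)) - (x + 1) * (cbin k / (2 * real k + (x + 2))))
          sums (x * cbin_series x - (x + 1) * cbin_series (x + 2))"
    unfolding cbin_series_def using assms
    by (intro sums_diff sums_mult summable_sums summable_cbin_divide) auto
  with * show ?thesis
    unfolding eq using sums_unique2 by fastforce
qed

text \<open>Fixes the normalisation: at x = 2 the terms are themselves the differences of
  consecutive \<open>cbin\<close> values.\<close>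

lemma cbin_series_2: "cbin_series 2 = 1"
proof -
  have "(\<lambda>k. cbin k - cbin (Suc k)) sums (cbin 0 - 0)"
    by (rule telescope_sums'[OF cbin_tendsto_0])
  moreover have "cbin k - cbin (Suc k) = cbin k / (2 * real k + 2)" for k
    using cbin_Suc[of k] by (simp add: field_simps)
  ultimately show ?thesis
    by (simp add: cbin_series_def sums_iff)
qed

text \<open>The recurrence keeps f/g constant along x + 2n, and f = g at the even points. For x in
  (0, 2] the point x + 2n lies between 2n and 2n + 2, so monotonicity bounds f/g by g(2n)/g(2n+2) =
  (2n+1)/(2n), which tends to 1. The hypotheses are symmetric in f and g, so swapping them gives
  equality.\<close>

lemma two_step_rec_le:
  fixes f g :: "real \<Rightarrow> real"
  assumes f_rec: "\<And>x. x > 0 \<Longrightarrow> (x + 1) * f (x + 2) = x * f x"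
      and g_rec: "\<And>x. x > 0 \<Longrightarrow> (x + 1) * g (x + 2) = x * g x"
      and f_mono: "\<And>x y. 0 < x \<Longrightarrow> x \<le> y \<Longrightarrow> f y \<le> f x"
      and g_mono: "\<And>x y. 0 < x \<Longrightarrow> x \<le> y \<Longrightarrow> g y \<le> g x"
      and f_pos: "\<And>x. x > 0 \<Longrightarrow> f x > 0"
      and g_pos: "\<And>x. x > 0 \<Longrightarrow> g x > 0"
      and eq2: "f 2 = g 2"
      and x: "0 < x" "x \<le> 2"
  shows "f x \<le> g x"
proof -
  \<comment> \<open>Constancy of f/g along steps of 2, cross-multiplied to avoid quotients.\<close>
  have ratio: "f (y + 2 * real n) * g y = f y * g (y + 2 * real n)" if "y > 0" for y n
  proof (induction n)
    case (Suc n)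
    let ?z = "y + 2 * real n"
    have z: "?z > 0" using that by simp
    have "(?z + 1) * (f (?z + 2) * g y) = ?z * (f ?z * g y)"
      using f_rec[OF z] by (metis mult.assoc)
    also have "\<dots> = (?z * g ?z) * f y"
      using Suc.IH by simp
    also have "\<dots> = (?z + 1) * (f y * g (?z + 2))"
      using g_rec[OF z] by (metis mult.assoc mult.commute)
    finally have "f (?z + 2) * g y = f y * g (?z + 2)"
      using z by (metis add_pos_pos less_irrefl mult_left_cancel zero_less_one)
    then show ?case
      by (simp add: algebra_simps)
  qed simp
  have le: "f x * (2 * real n / (2 * real n + 1)) \<le> g x" if n: "n \<ge> 1" for n
  proof -
    let ?m = "2 * real n"
    have m: "?m > 0" using n by simp
    \<comment> \<open>The point 2n is reached from 2 in n - 1 steps, hence the assumption n >=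
      1.\<close>
    have even_eq: "f ?m = g ?m"
      using ratio[of 2 "n - 1"] eq2 g_pos[of 2] n by (simp add: of_nat_diff algebra_simps)
    have "f x * g (?m + 2) \<le> f x * g (x + ?m)"
      using x f_pos[of x] g_mono[of "x + ?m" "?m + 2"] n by (intro mult_left_mono) auto
    also have "\<dots> = f (x + ?m) * g x"
      using ratio[of x n] x by simp
    also have "\<dots> \<le> f ?m * g x"
      using x g_pos[of x] f_mono[of ?m "x + ?m"] n by (intro mult_right_mono) auto
    finally have "f x * g (?m + 2) \<le> g ?m * g x"
      unfolding even_eq .
    moreover have "g (?m + 2) = g ?m * (?m / (?m + 1))"
      using g_rec[OF m] m by (simp add: field_simps)
    ultimately have "g ?m * (f x * (?m / (?m + 1))) \<le> g ?m * g x"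
      by (simp add: mult_ac)
    then show ?thesis
      using g_pos[OF m] by (rule mult_left_le_imp_le)
  qed
  have "(\<lambda>n. 2 * real n / (2 * real n + 1)) \<longlonglongrightarrow> 1"
    by real_asymp
  then have "(\<lambda>n. f x * (2 * real n / (2 * real n + 1))) \<longlonglongrightarrow> f x * 1"
    by (rule tendsto_mult_left)
  then show ?thesis
    using le by (intro LIMSEQ_le_const2[of _ "f x" "g x"]) auto
qed

lemma cbin_series_eq_Beta:
  assumes "0 < x" "x \<le> 2"
  shows "cbin_series x = Beta (1 / 2) (x / 2) / 2"
proof -
  define g :: "real \<Rightarrow> real" where "g x = Beta (1 / 2) (x / 2) / 2" for x
  have g_rec: "(x + 1) * g (x + 2) = x * g x" if "x > 0" for x
  proof -
    have "x / 2 \<notin> \<int>\<^sub>\<le>\<^sub>0"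
      using that by (auto elim!: nonpos_Ints_cases)
    from Beta_plus1_right[OF this, of "1 / 2"] show ?thesis
      by (simp add: g_def field_simps)
  qed
  have g_pos: "g x > 0" if "x > 0" for x
    using that by (auto simp: g_def Beta_def intro!: mult_pos_pos divide_pos_pos Gamma_real_pos)
  have g_mono: "g y \<le> g x" if "0 < x" "x \<le> y" for x y
    using that by (simp add: g_def Beta_real_mono)
  \<comment> \<open>Gives B(1/2, 1) = Gamma(1/2) / Gamma(3/2) = 2, so the factor 1/2 in
    \<open>g\<close> matches the value of the series at 2.\<close>
  have "Gamma (3 / 2 :: real) = Gamma (1 / 2) / 2"
  proof -
    have "(1 / 2 :: real) \<notin> \<int>\<^sub>\<le>\<^sub>0"
      by (auto elim!: nonpos_Ints_cases)
    from Gamma_plus1[OF this] show ?thesis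
      by simp
  qed
  then have g_2: "g 2 = 1"
    by (simp add: g_def Beta_def Gamma_one_half_real)
  note facts = cbin_series_rec cbin_series_antimono cbin_series_pos g_rec g_mono g_pos
  have "cbin_series x \<le> g x"
    by (rule two_step_rec_le) (use facts assms cbin_series_2 g_2 in auto)
  moreover have "g x \<le> cbin_series x"
    by (rule two_step_rec_le) (use facts assms cbin_series_2 g_2 in auto)
  ultimately show ?thesis
    by (simp add: g_def)
qed

section \<open>The complex domain without the poles\<close>

definition no_poles :: "complex set" where
  "no_poles = - {- 2 * of_nat n | n :: nat. True}"

text \<open>Restates the domain through the poles of Gamma, the form needed for openness and for
  holomorphy of Beta.\<close>

lemma no_poles_altdef: "no_poles = {u. u / 2 \<notin> \<int>\<^sub>\<le>\<^sub>0}"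
proof -
  have "(\<exists>n. u = - 2 * of_nat n) \<longleftrightarrow> (\<exists>n. u / 2 = - of_nat n)" for u :: complex
    by (rule ex_cong1) (auto simp: field_simps)
  then show ?thesis
    unfolding no_poles_def by (auto elim!: nonpos_Ints_cases')
qed

lemma open_no_poles: "open no_poles"
proof -
  have eq: "no_poles = - ((\<lambda>u. u / 2) -` \<int>\<^sub>\<le>\<^sub>0)"
    by (auto simp: no_poles_altdef)
  show ?thesis
    unfolding eq by (intro open_Compl closed_vimage closed_nonpos_Ints continuous_intros) auto
qed

lemma connected_no_poles: "connected no_poles"
proof -
  have "{- 2 * of_nat n | n :: nat. True} = range (\<lambda>n. - 2 * of_nat n :: complex)"
    by auto
  then have "countable {- 2 * of_nat n :: complex | n :: nat. True}"
    by simp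
  then show ?thesis
    unfolding no_poles_def Compl_eq_Diff_UNIV
    by (intro connected_open_diff_countable) auto
qed

lemma no_poles_nonzero: "u \<in> no_poles \<Longrightarrow> 2 * of_nat k + u \<noteq> 0"
  unfolding no_poles_def by (auto simp: add_eq_0_iff)

lemma no_poles_of_real: "x > 0 \<Longrightarrow> complex_of_real x \<in> no_poles"
  unfolding no_poles_def
  by (auto simp: complex_eq_iff)

section \<open>Locally uniform convergence and termwise differentiation\<close>

definition cbin_term :: "nat \<Rightarrow> nat \<Rightarrow> complex \<Rightarrow> complex" where
  "cbin_term p k u = of_real (cbin k) / (2 * of_nat k + u) ^ (p + 1)"

lemma cbin_term_has_field_derivative:
  assumes "u \<in> no_poles"
  shows "(cbin_term p k has_field_derivative - of_nat (Suc p) * cbin_term (Suc p) k u) (at u)"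
proof -
  define d where "d = 2 * of_nat k + u"
  have d: "d \<noteq> 0"
    using no_poles_nonzero[OF assms] by (simp add: d_def)
  have "((\<lambda>u. (2 * of_nat k + u) ^ (p + 1)) has_field_derivative of_nat (Suc p) * d ^ p) (at u)"
    by (rule derivative_eq_intros refl)+ (simp add: d_def)
  from DERIV_divide[OF DERIV_const this] have "(cbin_term p k has_field_derivative
      - (of_real (cbin k) * (of_nat (Suc p) * d ^ p)) / (d ^ (p + 1) * d ^ (p + 1))) (at u)"
    unfolding cbin_term_def using d by (simp add: d_def)
  also have "- (of_real (cbin k) * (of_nat (Suc p) * d ^ p)) / (d ^ (p + 1) * d ^ (p + 1))
      = - of_nat (Suc p) * cbin_term (Suc p) k u"
    unfolding cbin_term_def d_def[symmetric] using d by (simp add: divide_simps) (simp add: algebra_simps)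
  finally show ?thesis .
qed

text \<open>Here |2k + u| >= 2k - |u| >= k >= 1, so raising to the power p + 1 only enlarges the
  denominator and one majorant serves all p.\<close>

lemma norm_cbin_term_le:
  assumes "1 \<le> k" "norm u \<le> real k"
  shows "norm (cbin_term p k u) \<le> cbin k / real k"
proof -
  have "2 * real k - norm u \<le> norm (2 * of_nat k + u)"
    using norm_diff_ineq[of "2 * of_nat k" u] by (simp add: norm_mult)
  with assms have k: "real k \<le> norm (2 * of_nat k + u)"
    by simp
  also have "\<dots> \<le> norm (2 * of_nat k + u) ^ (p + 1)"
    using assms k by (intro self_le_power) auto
  finally have "cbin k / norm (2 * of_nat k + u) ^ (p + 1) \<le> cbin k / real k"
    using assms cbin_nonneg[of k] by (intro divide_left_mono) auto
  then show ?thesis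
    using cbin_nonneg[of k] by (simp add: cbin_term_def norm_divide norm_mult norm_power)
qed

lemma cbin_term_series:
  "\<exists>g g'. \<forall>u \<in> no_poles. (\<lambda>k. cbin_term p k u) sums g u \<and>
     (\<lambda>k. - of_nat (Suc p) * cbin_term (Suc p) k u) sums g' u \<and> (g has_field_derivative g' u) (at u)"
proof (rule series_and_derivative_comparison_local[OF open_no_poles])
  fix u assume "u \<in> no_poles"
  \<comment> \<open>The extra 1 is the radius of the ball: for k >= N the majorant then holds on all
    of \<open>ball u 1\<close>.\<close>
  obtain N where N: "real N \<ge> norm u + 1"
    using real_arch_simple by blast
  have "norm y \<le> real k" if "k \<ge> N" "y \<in> ball u 1" for k y
  proof -
    have "norm y \<le> norm u + dist u y"
      using norm_triangle_sub[of y u] by (simp add: dist_norm norm_minus_commute)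
    then show ?thesis
      using that N by simp
  qed
  then have "\<forall>\<^sub>F k in sequentially. \<forall>y\<in>ball u 1 \<inter> no_poles. norm (cbin_term p k y) \<le> cbin k / real k"
    by (intro eventually_sequentiallyI[of "max 1 N"]) (auto intro!: norm_cbin_term_le)
  then show "\<exists>d h. 0 < d \<and> summable h \<and>
      (\<forall>\<^sub>F k in sequentially. \<forall>y\<in>ball u d \<inter> no_poles. norm (cbin_term p k y) \<le> h k)"
    using summable_cbin zero_less_one by blast
qed (rule cbin_term_has_field_derivative)

definition cbin_F :: "nat \<Rightarrow> complex \<Rightarrow> complex" where
  "cbin_F p u = (\<Sum>k. cbin_term p k u)"

lemma cbin_F_sums:
  assumes "u \<in> no_poles"
  shows "(\<lambda>k. cbin_term p k u) sums cbin_F p u"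
  using cbin_term_series[of p] assms unfolding cbin_F_def by (metis sums_unique)

lemma cbin_F_has_field_derivative:
  assumes u: "u \<in> no_poles"
  shows "(cbin_F p has_field_derivative - of_nat (Suc p) * cbin_F (Suc p) u) (at u)"
proof -
  obtain g g' where g: "\<And>u. u \<in> no_poles \<Longrightarrow> (\<lambda>k. cbin_term p k u) sums g u"
     "\<And>u. u \<in> no_poles \<Longrightarrow> (\<lambda>k. - of_nat (Suc p) * cbin_term (Suc p) k u) sums g' u"
     "\<And>u. u \<in> no_poles \<Longrightarrow> (g has_field_derivative g' u) (at u)"
    using cbin_term_series[of p] by blast
  \<comment> \<open>The derivative supplied by the comparison theorem is the sum of the
    differentiated terms, so uniqueness of sums identifies it.\<close>
  have "g' u = - of_nat (Suc p) * cbin_F (Suc p) u"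
    using g(2)[OF u] sums_mult[OF cbin_F_sums[OF u]] by (rule sums_unique2)
  moreover have "g v = cbin_F p v" if "v \<in> no_poles" for v
    using g(1)[OF that] by (simp add: cbin_F_def sums_iff)
  ultimately show ?thesis
    using g(3)[OF u] has_field_derivative_transform_within_open[OF _ open_no_poles u] by metis
qed

section \<open>Analytic continuation, higher derivatives and the Taylor series\<close>

lemma cbin_F_0_of_real:
  assumes "0 < x" "x \<le> 2"
  shows "cbin_F 0 (of_real x) = Beta (1 / 2) (of_real x / 2) / 2"
proof -
  have "(\<lambda>k. cbin k / (2 * real k + x)) sums cbin_series x"
    unfolding cbin_series_def by (intro summable_sums summable_cbin_divide assms)
  then have "(\<lambda>k. complex_of_real (cbin k / (2 * real k + x))) sums of_real (cbin_series x)"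
    by (simp only: sums_of_real_iff)
  then have "(\<lambda>k. cbin_term 0 k (of_real x)) sums of_real (cbin_series x)"
    by (simp add: cbin_term_def)
  then have "cbin_F 0 (of_real x) = of_real (cbin_series x)"
    by (simp add: cbin_F_def sums_iff)
  also have "\<dots> = Beta (1 / 2) (of_real x / 2) / 2"
    using Beta_complex_of_real[of "1 / 2" "x / 2"] by (simp add: cbin_series_eq_Beta assms)
  finally show ?thesis .
qed

lemma Beta_half_holomorphic: "(\<lambda>u. Beta (1 / 2) (u / 2)) holomorphic_on no_poles"
proof -
  have "(1 / 2 :: complex) \<notin> \<int>\<^sub>\<le>\<^sub>0"
  proof
    assume "(1 / 2 :: complex) \<in> \<int>\<^sub>\<le>\<^sub>0"
    then obtain n where "n \<le> 0" "(1 / 2 :: complex) = of_int n"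
      by (rule nonpos_Ints_cases)
    then show False
      by (auto dest: arg_cong[where f = Re])
  qed
  then show ?thesis
    by (intro holomorphic_intros) (auto simp: no_poles_altdef)
qed

lemma cbin_F_0:
  assumes "u \<in> no_poles"
  shows "cbin_F 0 u = Beta (1 / 2) (u / 2) / 2"
proof -
  let ?h = "\<lambda>u. cbin_F 0 u - Beta (1 / 2) (u / 2) / 2"
  have "cbin_F 0 holomorphic_on no_poles"
    using cbin_F_has_field_derivative open_no_poles by (auto simp: holomorphic_on_open)
  then have hol: "?h holomorphic_on no_poles"
    by (intro holomorphic_intros Beta_half_holomorphic) auto
  \<comment> \<open>The identity theorem needs zeros of \<open>?h\<close> accumulating inside the
    domain; the embedded interval (0, 2) accumulates at its interior point 1.\<close>
  have "(1 :: real) islimpt {0<..<2}"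
    by (intro interior_limit_point) (simp add: interior_open)
  then have lim: "of_real 1 islimpt (complex_of_real ` {0<..<2})"
    by (intro islimpt_isCont_image) (auto simp: eventually_at_filter)
  have "?h u = 0"
    by (rule analytic_continuation[OF hol open_no_poles connected_no_poles _ _ lim _ assms])
       (auto simp: cbin_F_0_of_real no_poles_of_real intro!: no_poles_of_real[of 1, simplified])
  then show ?thesis
    by simp
qed

lemma higher_deriv_Beta_half:
  assumes "u \<in> no_poles"
  shows "(deriv ^^ p) (\<lambda>u. Beta (1 / 2) (u / 2)) u = 2 * (-1) ^ p * fact p * cbin_F p u"
  using assms
proof (induction p arbitrary: u)
  case 0
  then show ?case
    by (simp add: cbin_F_0)
next
  case (Suc p)
  have "((\<lambda>u. 2 * (-1) ^ p * fact p * cbin_F p u) has_field_derivative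
      2 * (-1) ^ p * fact p * (- of_nat (Suc p) * cbin_F (Suc p) u)) (at u)"
    by (intro DERIV_cmult cbin_F_has_field_derivative Suc.prems)
  then have "((deriv ^^ p) (\<lambda>u. Beta (1 / 2) (u / 2)) has_field_derivative
      2 * (-1) ^ p * fact p * (- of_nat (Suc p) * cbin_F (Suc p) u)) (at u)"
    \<comment> \<open>The induction hypothesis holds on the whole open domain, not just at u, so
      both sides may be differentiated.\<close>
    by (rule has_field_derivative_transform_within_open[OF _ open_no_poles Suc.prems])
       (simp add: Suc.IH)
  then show ?case
    by (simp add: DERIV_imp_deriv algebra_simps)
qed

theorem theorem6p3:
  fixes w :: complex
  assumes w: "w \<notin> {- 2 * of_nat n | n :: nat. True}"
  shows
    "(\<forall>p::nat.
        (\<lambda>k. of_nat ((2 * k) choose k) / (4 ^ k * (2 * of_nat k + w) ^ (p + 1)))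
        sums ((-1) ^ p / (2 * fact p) * (deriv ^^ p) (\<lambda>u. Beta (1/2) (u/2)) w))
     \<and> (\<exists>r::real. r > 0 \<and> (\<forall>z::complex. norm z < r \<longrightarrow>
        (\<lambda>p. (\<Sum>k. of_nat ((2 * k) choose k) / (4 ^ k * (2 * of_nat k + w) ^ (p + 1))) * z ^ p)
        sums (1/2 * Beta (1/2) ((w - z) / 2))))"
proof -
  have w': "w \<in> no_poles"
    using w by (simp add: no_poles_def)
  have term_eq: "of_nat ((2 * k) choose k) / (4 ^ k * (2 * of_nat k + w) ^ (p + 1)) = cbin_term p k w" for p k
    by (simp add: cbin_term_def cbin_def)
  have F_eq: "cbin_F p w = (-1) ^ p / (2 * fact p) * (deriv ^^ p) (\<lambda>u. Beta (1/2) (u/2)) w" for p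
    by (simp add: higher_deriv_Beta_half[OF w'] power_mult_distrib[symmetric])
  \<comment> \<open>Any pole-free disc around w serves: the Taylor series of Beta converges to it
    there.\<close>
  obtain r where r: "r > 0" "ball w r \<subseteq> no_poles"
    using open_no_poles w' open_contains_ball by blast
  have "(\<lambda>p. cbin_F p w * z ^ p) sums (1/2 * Beta (1/2) ((w - z) / 2))" if "norm z < r" for z
  proof -
    \<comment> \<open>Taylor expansion about w evaluated at w - z. The increment is -z, whose sign
      (-1)^p supplies the sign in the derivative formula for \<open>cbin_F p w\<close>.\<close>
    have "(\<lambda>p. (deriv ^^ p) (\<lambda>u. Beta (1/2) (u/2)) w / fact p * (w - z - w) ^ p)
        sums Beta (1/2) ((w - z) / 2)"
      using that r
      by (intro holomorphic_power_series[where r = r] holomorphic_on_subset[OF Beta_half_holomorphic])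
         (auto simp: dist_norm)
    then have "(\<lambda>p. 1/2 * ((deriv ^^ p) (\<lambda>u. Beta (1/2) (u/2)) w / fact p * (- z) ^ p))
        sums (1/2 * Beta (1/2) ((w - z) / 2))"
      by (intro sums_mult) simp
    moreover have "1/2 * ((deriv ^^ p) (\<lambda>u. Beta (1/2) (u/2)) w / fact p * (- z) ^ p)
        = cbin_F p w * z ^ p" for p
      unfolding F_eq power_minus[of z] by simp
    ultimately show ?thesis
      by simp
  qed
  then show ?thesis
    unfolding term_eq F_eq[symmetric] cbin_F_def[symmetric]
    using cbin_F_sums[OF w'] r(1) by blast
qed

end
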